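(* Let $Y$ be a 2nd countable topological space and let $\{A_\gamma:\gamma\in\Gamma\}$ be a family of (pairwise) disjoint 1st category subsets of $Y$. If the union $E=\bigcup_{\gamma\in\Gamma}A_\gamma$ is 2nd category, then there exist $\Delta\subset\Gamma$ and a (non-empty) open set $O\subset Y$ such that both $\bigcup_{\gamma\in\Delta}A_\gamma$ and $\bigcup_{\gamma\in\Gamma\setminus\Delta}A_\gamma$ are everywhere 2nd category in $O$. In consequence, $\bigcup_{\gamma\in\Delta}A_\gamma$ and $\bigcup_{\gamma\in\Gamma\setminus\Delta}A_\gamma$ cannot be separated by sets having the Baire property.
   Context: A subset of a topological space $Y$ is 1st category (meager) if it is a countable union of nowhere dense sets, and 2nd category if it is not 1st category. A set $E\subset Y$ is 2nd category at a point $x\in Y$ if $E\cap V$ is 2nd category for every neighborhood $V$ of $x$; $E$ is everywhere 2nd category in a set $P$ if it is 2nd category at each point of $P$. A set $A\subset Y$ has the Baire property if $A=(O\setminus P)\cup Q$ with $O$ open and $P,Q$ 1st category. Two sets $F_1,F_2\subset Y$ cannot be separated by sets having the Baire property if there is no $G\subset Y$ with the Baire property such that $F_1\subset G$ and $G\cap F_2=\emptyset$. A space is 2nd countable if it has a countable base of open sets. *)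

theory Defs
  imports "HOL-Analysis.Analysis" "HOL-Library.Disjoint_Sets"
begin

definition nowhere_dense :: "'a::topological_space set \<Rightarrow> bool"
  where "nowhere_dense A \<longleftrightarrow> interior (closure A) = {}"

definition first_category :: "'a::topological_space set \<Rightarrow> bool"
  where "first_category A \<longleftrightarrow>
    (\<exists>\<N>. countable \<N> \<and> (\<forall>N\<in>\<N>. nowhere_dense N) \<and> A = \<Union>\<N>)"

definition second_category :: "'a::topological_space set \<Rightarrow> bool"
  where "second_category A \<longleftrightarrow> \<not> first_category A"

text \<open>Only open neighbourhoods are quantified over. Since a superset of a second category set
  is of second category, allowing arbitrary neighbourhoods gives the same notion.\<close>
definition second_category_at :: "'a::topological_space set \<Rightarrow> 'a \<Rightarrow> bool"
  where "second_category_at E x \<longleftrightarrow> (\<forall>V. open V \<and> x \<in> V \<longrightarrow> second_category (E \<inter> V))"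

text \<open>The set \<open>E\<close> is not required to be contained in \<open>P\<close>.\<close>
definition everywhere_second_category_in :: "'a::topological_space set \<Rightarrow> 'a set \<Rightarrow> bool"
  where "everywhere_second_category_in E P \<longleftrightarrow> (\<forall>x\<in>P. second_category_at E x)"

definition baire_property :: "'a::topological_space set \<Rightarrow> bool"
  where "baire_property A \<longleftrightarrow>
    (\<exists>U P Q. open U \<and> first_category P \<and> first_category Q \<and> A = (U - P) \<union> Q)"

definition separated_by_baire_property :: "'a::topological_space set \<Rightarrow> 'a set \<Rightarrow> bool"
  where "separated_by_baire_property F\<^sub>1 F\<^sub>2 \<longleftrightarrow>
    (\<exists>G. baire_property G \<and> F\<^sub>1 \<subseteq> G \<and> G \<inter> F\<^sub>2 = {})"

end

theory Submission
  imports Defs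
begin

text \<open>Shrinking \<open>\<Gamma>\<close> to an initial segment of a well-order, one may assume that proper initial
  segments have first category union. If no \<open>\<Delta>\<close> and no open set split \<open>E\<close>, then every subunion is
  a relatively open subset of \<open>E\<close> modulo first category. Cover the union of all \<open>A\<^sub>\<delta>\<close> with
  \<open>\<delta> < \<gamma>\<close> by closed sets \<open>F\<^sub>n(\<gamma>)\<close> with empty interior. Applied to the sets
  \<open>{\<gamma>. F\<^sub>n(\<gamma>) \<inter> V = {}}\<close> with \<open>V\<close> basic open, the relative openness makes the planar sets
  \<open>{(x, y). x \<in> A\<^sub>\<gamma>, y \<in> F\<^sub>n(\<gamma>)}\<close> closed modulo first category, and a
  Kuratowski-Ulam argument gives a \<open>y \<in> A\<^sub>\<delta>\<close> whose horizontal sections all have first category. So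
  the union of all \<open>A\<^sub>\<gamma>\<close> with \<open>\<gamma> > \<delta>\<close> is first category, and therefore so is \<open>E\<close>.\<close>

section \<open>First category sets and the local nature of category\<close>

lemma first_category_subset:
  assumes "first_category B" "A \<subseteq> B"
  shows "first_category A"
proof -
  obtain \<N> where N: "countable \<N>" "\<And>N. N \<in> \<N> \<Longrightarrow> nowhere_dense N" "B = \<Union>\<N>"
    using assms(1) unfolding first_category_def by blast
  have "nowhere_dense (N \<inter> A)" if "N \<in> \<N>" for N
    using N(2)[OF that] interior_mono[OF closure_mono[of "N \<inter> A" N]]
    unfolding nowhere_dense_def by blast
  moreover have "A = \<Union>((\<lambda>N. N \<inter> A) ` \<N>)"
    using assms(2) N(3) by blast
  ultimately show ?thesis
    unfolding first_category_def using N(1) by (intro exI[of _ "(\<lambda>N. N \<inter> A) ` \<N>"]) auto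
qed

lemma first_category_UN:
  assumes "countable I" "\<And>i. i \<in> I \<Longrightarrow> first_category (B i)"
  shows "first_category (\<Union>i\<in>I. B i)"
proof -
  obtain \<N> where N: "\<And>i. i \<in> I \<Longrightarrow> countable (\<N> i) \<and> (\<forall>N\<in>\<N> i. nowhere_dense N) \<and> B i = \<Union>(\<N> i)"
    using assms(2) unfolding first_category_def by metis
  show ?thesis
    unfolding first_category_def
    using N assms(1) by (intro exI[of _ "\<Union>i\<in>I. \<N> i"]) auto
qed

lemma first_category_Un:
  assumes "first_category A" "first_category B"
  shows "first_category (A \<union> B)"
  using first_category_UN[of UNIV "\<lambda>b::bool. if b then A else B"] assms
  by (auto simp: UNIV_bool Un_commute)

lemma first_category_closed:
  assumes "closed C" "interior C = {}"
  shows "first_category C"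
  using assms unfolding first_category_def nowhere_dense_def
  by (intro exI[of _ "{C}"]) auto

lemma first_category_Compl_dense:
  assumes "open W" "\<And>U. open U \<Longrightarrow> U \<noteq> {} \<Longrightarrow> U \<inter> W \<noteq> {}"
  shows "first_category (- W)"
proof (rule first_category_closed)
  show "interior (- W) = {}"
    using assms(2)[of "interior (- W)"] interior_subset[of "- W"] by auto
qed (use assms(1) in auto)

lemma first_category_coverE:
  assumes "first_category A"
  obtains F :: "nat \<Rightarrow> 'a::topological_space set"
  where "\<And>n. closed (F n)" "\<And>n. interior (F n) = {}" "A \<subseteq> (\<Union>n. F n)"
proof -
  obtain \<N> where N: "countable \<N>" "\<And>N. N \<in> \<N> \<Longrightarrow> nowhere_dense N" "A = \<Union>\<N>"
    using assms unfolding first_category_def by blast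
  \<comment> \<open>Closures of nowhere dense sets are closed with empty interior. The extra
    \<open>{}\<close> keeps the family non-empty, so that \<open>from_nat_into\<close> enumerates it
    even when \<open>\<N>\<close> is empty.\<close>
  define \<M> where "\<M> = insert {} (closure ` \<N>)"
  have M: "countable \<M>" "\<M> \<noteq> {}" "\<forall>C\<in>\<M>. closed C \<and> interior C = {}" "A \<subseteq> \<Union>\<M>"
    using N closure_subset unfolding \<M>_def nowhere_dense_def by (auto, blast)
  show thesis
  proof
    show "closed (from_nat_into \<M> n)" "interior (from_nat_into \<M> n) = {}" for n
      using M(3) from_nat_into[OF M(2), of n] by auto
    show "A \<subseteq> (\<Union>n. from_nat_into \<M> n)"
      using M(4) range_from_nat_into[OF M(2,1)] by simp
  qed
qed

lemma nonempty_of_not_first_category: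
  assumes "\<not> first_category A" "first_category B"
  obtains x where "x \<in> A" "x \<notin> B"
  using assms first_category_subset by blast

text \<open>The Banach category theorem; a countable base makes it an instance of Lindeloef's theorem.\<close>
lemma first_category_locally:
  fixes A :: "'a::second_countable_topology set"
  shows "first_category (A \<inter> \<Union>{W. open W \<and> first_category (A \<inter> W)})"
proof -
  obtain \<F> where F: "\<F> \<subseteq> {W. open W \<and> first_category (A \<inter> W)}" "countable \<F>"
      "\<Union>\<F> = \<Union>{W. open W \<and> first_category (A \<inter> W)}"
    using Lindelof[of "{W. open W \<and> first_category (A \<inter> W)}"] by auto
  have "first_category (\<Union>W\<in>\<F>. A \<inter> W)"
    using F(1) by (intro first_category_UN[OF F(2)]) auto
  moreover have "(\<Union>W\<in>\<F>. A \<inter> W) = A \<inter> \<Union>{W. open W \<and> first_category (A \<inter> W)}"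
    unfolding F(3)[symmetric] by (rule Int_Union[symmetric])
  ultimately show ?thesis by simp
qed

text \<open>Adjoin to \<open>W\<close> the open set \<open>K\<close> of points near which
  \<open>E\<close> is first category. The result is dense: a non-empty open set in which
  \<open>E\<close> is first category lies in \<open>K\<close>, and any other meets \<open>W\<close>.
  So \<open>E - W\<close> is covered by a nowhere dense set and by \<open>E \<inter> K\<close>,
  which is first category by the Banach category theorem.\<close>

lemma first_category_diff_open:
  fixes E :: "'a::second_countable_topology set"
  assumes "open W" "\<And>U. open U \<Longrightarrow> \<not> first_category (E \<inter> U) \<Longrightarrow> U \<inter> W \<noteq> {}"
  shows "first_category (E - W)"
proof -
  define K where "K = \<Union>{W. open W \<and> first_category (E \<inter> W)}"
  have "first_category (- (W \<union> K))"
  proof (rule first_category_Compl_dense)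
    show "open (W \<union> K)"
      using assms(1) unfolding K_def by auto
    show "U \<inter> (W \<union> K) \<noteq> {}" if "open U" "U \<noteq> {}" for U
      using that assms(2)[of U] unfolding K_def by blast
  qed
  moreover have "first_category (E \<inter> K)"
    unfolding K_def by (rule first_category_locally)
  ultimately show ?thesis
    by (rule first_category_subset[OF first_category_Un]) blast
qed

section \<open>Splitting, relative openness and separation\<close>

text \<open>The witness is \<open>K T\<close>, the largest open set in which \<open>T\<close> is
  first category. Without a splitting, every non-empty open set contains a point at which
  \<open>S\<close> or \<open>T\<close> is not second category. Hence \<open>K S \<union> K T\<close>
  is dense, and \<open>S - K T\<close> lies in its complement together with
  \<open>S \<inter> K S\<close>.\<close>

lemma relatively_open_if_not_split:
  fixes S T :: "'a::second_countable_topology set"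
  assumes "\<nexists>U. open U \<and> U \<noteq> {} \<and> everywhere_second_category_in S U \<and>
      everywhere_second_category_in T U"
  shows "\<exists>W. open W \<and> first_category (S - W) \<and> first_category (T \<inter> W)"
proof -
  define K where "K X = \<Union>{W. open W \<and> first_category (X \<inter> W)}" for X :: "'a set"
  have K: "first_category (X \<inter> K X)" "open (K X)" for X
    using first_category_locally unfolding K_def by auto
  have "first_category (- (K S \<union> K T))"
  proof (rule first_category_Compl_dense)
    show "U \<inter> (K S \<union> K T) \<noteq> {}" if U: "open U" "U \<noteq> {}" for U
    proof -
      have "x \<in> K X" if "\<not> second_category_at X x" for X x
        using that unfolding K_def second_category_at_def second_category_def by blast
      moreover obtain x where "x \<in> U" "\<not> second_category_at S x \<or> \<not> second_category_at T x"
        using assms U unfolding everywhere_second_category_in_def by metis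
      ultimately show ?thesis
        by blast
    qed
  qed (use K in auto)
  then have "first_category (S - K T)"
    by (rule first_category_subset[OF first_category_Un[OF _ K(1)[of S]]]) blast
  with K show ?thesis by blast
qed

text \<open>If \<open>(W - P) \<union> Q\<close> separated the sets, \<open>S\<close> would have
  points in \<open>U\<close> off \<open>Q\<close>, so \<open>W\<close> would meet \<open>U\<close>.
  There \<open>T\<close> is second category, yet its part in \<open>W\<close> would lie in
  \<open>P\<close>.\<close>

lemma not_separated_if_split:
  assumes "open U" "U \<noteq> {}" "everywhere_second_category_in S U" "everywhere_second_category_in T U"
  shows "\<not> separated_by_baire_property S T"
proof
  assume "separated_by_baire_property S T"
  then obtain W P Q where *: "open W" "first_category P" "first_category Q"
      "S \<subseteq> (W - P) \<union> Q" "((W - P) \<union> Q) \<inter> T = {}"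
    unfolding separated_by_baire_property_def baire_property_def by blast
  have "\<not> first_category (S \<inter> U)"
    using assms
    unfolding everywhere_second_category_in_def second_category_at_def second_category_def by blast
  then obtain x where x: "x \<in> S" "x \<in> U" "x \<notin> Q"
    using *(3) by (blast elim: nonempty_of_not_first_category)
  then have "x \<in> U \<inter> W"
    using *(4) by blast
  then have "\<not> first_category (T \<inter> (U \<inter> W))"
    using assms *(1)
    unfolding everywhere_second_category_in_def second_category_at_def second_category_def by blast
  then obtain z where "z \<in> T" "z \<in> W" "z \<notin> P"
    using *(2) by (blast elim: nonempty_of_not_first_category)
  then show False
    using *(5) by blast
qed

section \<open>The Kuratowski-Ulam argument over a countable base\<close>

lemma nat_indexed_base:
  obtains V :: "nat \<Rightarrow> 'a::second_countable_topology set"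
  where "\<And>k. open (V k)" "\<And>S x. open S \<Longrightarrow> x \<in> S \<Longrightarrow> \<exists>k. x \<in> V k \<and> V k \<subseteq> S"
proof -
  obtain \<B> :: "'a set set" where B: "countable \<B>" "topological_basis \<B>"
    using ex_countable_basis by blast
  have "\<B> \<noteq> {}"
    using topological_basisE[OF B(2) open_UNIV UNIV_I] by blast
  then have r: "range (from_nat_into \<B>) = \<B>"
    using B(1) by (rule range_from_nat_into)
  show thesis
  proof
    show "open (from_nat_into \<B> k)" for k
      using r topological_basis_open[OF B(2)] by blast
    show "\<exists>k. x \<in> from_nat_into \<B> k \<and> from_nat_into \<B> k \<subseteq> S" if "open S" "x \<in> S" for S x
      using topological_basisE[OF B(2) that] r by (metis rangeE)
  qed
qed

text \<open>\<open>L\<close> is meant as the strict order of the indices. By \<open>above\<close> it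
  is enough to find one \<open>\<delta>\<close> such that the \<open>A \<gamma>\<close> with
  \<open>\<gamma>\<close> after \<open>\<delta>\<close> also have first category union. If
  \<open>E\<close> is second category, the index of a generic point \<open>y\<close> of
  \<open>E\<close> is such a \<open>\<delta>\<close>.\<close>

lemma first_category_union_if_subunions_relatively_open:
  fixes A :: "'i \<Rightarrow> 'a::second_countable_topology set" and L :: "('i \<times> 'i) set"
  assumes below: "\<And>\<gamma>. \<gamma> \<in> \<Gamma> \<Longrightarrow> first_category (\<Union>\<delta>\<in>{\<delta>\<in>\<Gamma>. (\<delta>, \<gamma>) \<in> L}. A \<delta>)"
    and above: "\<And>\<delta>. \<delta> \<in> \<Gamma> \<Longrightarrow> first_category (\<Union>\<gamma>\<in>{\<gamma>\<in>\<Gamma>. (\<delta>, \<gamma>) \<notin> L}. A \<gamma>)"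
    and rel: "\<And>\<Delta>. \<Delta> \<subseteq> \<Gamma> \<Longrightarrow> \<exists>W. open W \<and> first_category ((\<Union>\<gamma>\<in>\<Delta>. A \<gamma>) - W) \<and>
                first_category ((\<Union>\<gamma>\<in>\<Gamma> - \<Delta>. A \<gamma>) \<inter> W)"
  shows "first_category (\<Union>\<gamma>\<in>\<Gamma>. A \<gamma>)"
proof (rule ccontr)
  define E where "E = (\<Union>\<gamma>\<in>\<Gamma>. A \<gamma>)"
  assume "\<not> first_category (\<Union>\<gamma>\<in>\<Gamma>. A \<gamma>)"
  then have nE: "\<not> first_category E"
    unfolding E_def .
  obtain V :: "nat \<Rightarrow> 'a set" where V: "\<And>k. open (V k)"
      "\<And>S x. open S \<Longrightarrow> x \<in> S \<Longrightarrow> \<exists>k. x \<in> V k \<and> V k \<subseteq> S"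
    using nat_indexed_base by blast
  have "\<forall>\<gamma>\<in>\<Gamma>. \<exists>F. (\<forall>n::nat. closed (F n) \<and> interior (F n) = {}) \<and>
      (\<Union>\<delta>\<in>{\<delta>\<in>\<Gamma>. (\<delta>, \<gamma>) \<in> L}. A \<delta>) \<subseteq> (\<Union>n. F n)"
    using first_category_coverE[OF below] by metis
  from bchoice[OF this] obtain F :: "'i \<Rightarrow> nat \<Rightarrow> 'a set" where
      "\<forall>\<gamma>\<in>\<Gamma>. (\<forall>n. closed (F \<gamma> n) \<and> interior (F \<gamma> n) = {}) \<and>
        (\<Union>\<delta>\<in>{\<delta>\<in>\<Gamma>. (\<delta>, \<gamma>) \<in> L}. A \<delta>) \<subseteq> (\<Union>n. F \<gamma> n)" ..
  then have F: "\<And>\<gamma> n. \<gamma> \<in> \<Gamma> \<Longrightarrow> closed (F \<gamma> n)" "\<And>\<gamma> n. \<gamma> \<in> \<Gamma> \<Longrightarrow> interior (F \<gamma> n) = {}"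
      "\<And>\<gamma>. \<gamma> \<in> \<Gamma> \<Longrightarrow> (\<Union>\<delta>\<in>{\<delta>\<in>\<Gamma>. (\<delta>, \<gamma>) \<in> L}. A \<delta>) \<subseteq> (\<Union>n. F \<gamma> n)"
    by simp_all
  \<comment> \<open>For \<open>\<gamma> \<in> \<Gamma>\<close>, the closed set
    \<open>F \<gamma> n\<close> is the complement of the union of all \<open>V k\<close> with
    \<open>\<gamma> \<in> \<Delta> n k\<close>. Thus countably many index sets describe all the
    covers.\<close>
  define \<Delta> where "\<Delta> n k = {\<gamma>\<in>\<Gamma>. F \<gamma> n \<inter> V k = {}}" for n k
  have "\<forall>\<Delta>\<in>Pow \<Gamma>. \<exists>W. open W \<and> first_category ((\<Union>\<gamma>\<in>\<Delta>. A \<gamma>) - W) \<and>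
      first_category ((\<Union>\<gamma>\<in>\<Gamma> - \<Delta>. A \<gamma>) \<inter> W)"
    using rel by simp
  from bchoice[OF this] obtain w where w: "\<forall>\<Delta>\<in>Pow \<Gamma>. open (w \<Delta>) \<and>
      first_category ((\<Union>\<gamma>\<in>\<Delta>. A \<gamma>) - w \<Delta>) \<and> first_category ((\<Union>\<gamma>\<in>\<Gamma> - \<Delta>. A \<gamma>) \<inter> w \<Delta>)"
    by blast
  define W where "W n k = w (\<Delta> n k)" for n k
  have "\<Delta> n k \<in> Pow \<Gamma>" for n k
    unfolding \<Delta>_def by blast
  with w have W: "\<And>n k. open (W n k)"
      "\<And>n k. first_category ((\<Union>\<gamma>\<in>\<Delta> n k. A \<gamma>) - W n k)"
      "\<And>n k. first_category ((\<Union>\<gamma>\<in>\<Gamma> - \<Delta> n k. A \<gamma>) \<inter> W n k)"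
    unfolding W_def by simp_all
  \<comment> \<open>\<open>M\<close> gathers the countably many errors of relative openness. Off
    \<open>M\<close>, membership in \<open>W n k\<close> decides whether an index of the point
    belongs to \<open>\<Delta> n k\<close>.\<close>
  define M where "M = (\<Union>n. \<Union>k. ((\<Union>\<gamma>\<in>\<Delta> n k. A \<gamma>) - W n k) \<union> ((\<Union>\<gamma>\<in>\<Gamma> - \<Delta> n k. A \<gamma>) \<inter> W n k))"
  have M: "first_category M"
    unfolding M_def by (intro first_category_UN first_category_Un W) auto
  have W_iff: "x \<in> W n k \<longleftrightarrow> F \<gamma> n \<inter> V k = {}" if "\<gamma> \<in> \<Gamma>" "x \<in> A \<gamma>" "x \<notin> M" for x \<gamma> n k
    using that unfolding M_def \<Delta>_def by blast
  \<comment> \<open>Let \<open>G n\<close> be the planar open set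
    \<open>\<Union>k. W n k \<times> V k\<close>. For \<open>x \<in> A \<gamma>\<close> off
    \<open>M\<close>, its vertical section at \<open>x\<close> is the complement of
    \<open>F \<gamma> n\<close>. \<open>P n j\<close> is the projection to the second axis of the
    part of \<open>G n\<close> over \<open>V j\<close>.\<close>
  define P where "P n j = \<Union>{V k | k. W n k \<inter> V j \<noteq> {}}" for n j
  have P: "first_category (- P n j)" if j: "\<not> first_category (E \<inter> V j)" for n j
  proof (rule first_category_Compl_dense)
    show "open (P n j)"
      using V(1) unfolding P_def by auto
    show "U \<inter> P n j \<noteq> {}" if U: "open U" "U \<noteq> {}" for U
    proof -
      \<comment> \<open>One such \<open>x\<close> gives density: the vertical section at
        \<open>x\<close> is already dense, since \<open>F \<gamma> n\<close> has empty
        interior.\<close>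
      obtain x where x: "x \<in> E" "x \<in> V j" "x \<notin> M"
        using j M by (blast elim: nonempty_of_not_first_category)
      then obtain \<gamma> where \<gamma>: "\<gamma> \<in> \<Gamma>" "x \<in> A \<gamma>"
        unfolding E_def by blast
      have "\<not> U \<subseteq> F \<gamma> n"
        using F(2)[OF \<gamma>(1), of n] U interior_maximal by blast
      then obtain z where "z \<in> U - F \<gamma> n"
        by blast
      moreover have "open (U - F \<gamma> n)"
        using U(1) F(1)[OF \<gamma>(1)] by (rule open_Diff)
      ultimately obtain k where k: "z \<in> V k" "V k \<subseteq> U - F \<gamma> n"
        using V(2) by blast
      then have "x \<in> W n k"
        using W_iff[OF \<gamma> x(3)] by blast
      then show ?thesis
        using k x(2) unfolding P_def by blast
    qed
  qed
  have "first_category (\<Union>n. \<Union>j\<in>{j. \<not> first_category (E \<inter> V j)}. - P n j)"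
    by (intro first_category_UN P) auto
  from nonempty_of_not_first_category[OF nE this]
  obtain y where "y \<in> E" "y \<notin> (\<Union>n. \<Union>j\<in>{j. \<not> first_category (E \<inter> V j)}. - P n j)" .
  then have y: "y \<in> P n j" if "\<not> first_category (E \<inter> V j)" for n j
    using that by blast
  obtain \<delta> where \<delta>: "\<delta> \<in> \<Gamma>" "y \<in> A \<delta>"
    using \<open>y \<in> E\<close> unfolding E_def by blast
  \<comment> \<open>\<open>D n\<close> is the horizontal section of \<open>G n\<close> at height
    \<open>y\<close>. It meets each \<open>V j\<close> in which \<open>E\<close> is second category,
    because \<open>y \<in> P n j\<close>.\<close>
  define D where "D n = \<Union>{W n k | k. y \<in> V k}" for n
  have D: "first_category (E - D n)" for n
  proof (rule first_category_diff_open)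
    show "open (D n)"
      using W(1) unfolding D_def by auto
    show "U \<inter> D n \<noteq> {}" if U: "open U" "\<not> first_category (E \<inter> U)" for U
    proof -
      have "\<exists>j. V j \<subseteq> U \<and> \<not> first_category (E \<inter> V j)"
      proof (rule ccontr)
        assume "\<not> ?thesis"
        then have "first_category (\<Union>j\<in>{j. V j \<subseteq> U}. E \<inter> V j)"
          by (intro first_category_UN) auto
        moreover have "E \<inter> U \<subseteq> (\<Union>j\<in>{j. V j \<subseteq> U}. E \<inter> V j)"
          using V(2)[OF U(1)] by blast
        ultimately show False
          using U(2) first_category_subset by blast
      qed
      then obtain j where j: "V j \<subseteq> U" "y \<in> P n j"
        using y by blast
      then show ?thesis
        unfolding P_def D_def by blast
    qed
  qed
  have "E \<subseteq> (M \<union> (\<Union>\<gamma>\<in>{\<gamma>\<in>\<Gamma>. (\<delta>, \<gamma>) \<notin> L}. A \<gamma>)) \<union> (\<Union>n. E - D n)"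
  proof
    fix x assume x: "x \<in> E"
    then obtain \<gamma> where \<gamma>: "\<gamma> \<in> \<Gamma>" "x \<in> A \<gamma>"
      unfolding E_def by blast
    have "\<exists>n. x \<notin> D n" if "x \<notin> M" and L: "(\<delta>, \<gamma>) \<in> L"
    proof -
      \<comment> \<open>As \<open>\<delta>\<close> comes before \<open>\<gamma>\<close>, the point
        \<open>y\<close> of \<open>A \<delta>\<close> is covered by some
        \<open>F \<gamma> n\<close>. Every \<open>V k\<close> around \<open>y\<close> then meets
        \<open>F \<gamma> n\<close>, which keeps \<open>x\<close> out of
        \<open>W n k\<close>.\<close>
      obtain n where "y \<in> F \<gamma> n"
        using F(3)[OF \<gamma>(1)] \<delta> L by blast
      then have "x \<notin> W n k" if "y \<in> V k" for k
        using W_iff[OF \<gamma> \<open>x \<notin> M\<close>] that by blast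
      then show ?thesis
        unfolding D_def by blast
    qed
    then show "x \<in> (M \<union> (\<Union>\<gamma>\<in>{\<gamma>\<in>\<Gamma>. (\<delta>, \<gamma>) \<notin> L}. A \<gamma>)) \<union> (\<Union>n. E - D n)"
      using x \<gamma> by blast
  qed
  moreover have "first_category ((M \<union> (\<Union>\<gamma>\<in>{\<gamma>\<in>\<Gamma>. (\<delta>, \<gamma>) \<notin> L}. A \<gamma>)) \<union> (\<Union>n. E - D n))"
    by (intro first_category_Un M above[OF \<delta>(1)] first_category_UN D) auto
  ultimately show False
    using nE first_category_subset by blast
qed

section \<open>Reduction to a minimal initial segment, and the conclusion\<close>

lemma everywhere_second_category_in_mono:
  assumes "everywhere_second_category_in S U" "S \<subseteq> T"
  shows "everywhere_second_category_in T U"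
proof -
  have "first_category (S \<inter> V)" if "first_category (T \<inter> V)" for V
    using that assms(2) by (blast intro: first_category_subset)
  then show ?thesis
    using assms(1)
    unfolding everywhere_second_category_in_def second_category_at_def second_category_def by blast
qed

text \<open>Well-order the whole index type and cut \<open>\<Gamma>\<close> at the least index below
  which the union is second category. If there is no such index, \<open>\<Gamma>\<close> itself
  serves.\<close>

lemma minimal_second_category_subfamily:
  fixes A :: "'i \<Rightarrow> 'a::topological_space set"
  assumes "\<not> first_category (\<Union>\<gamma>\<in>\<Gamma>. A \<gamma>)"
  obtains \<Gamma>' and r :: "('i \<times> 'i) set" where "\<Gamma>' \<subseteq> \<Gamma>" "\<not> first_category (\<Union>\<gamma>\<in>\<Gamma>'. A \<gamma>)"
    "total r" "\<And>\<gamma>. \<gamma> \<in> \<Gamma>' \<Longrightarrow> first_category (\<Union>\<delta>\<in>{\<delta>\<in>\<Gamma>'. (\<delta>, \<gamma>) \<in> r - Id}. A \<delta>)"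
proof -
  obtain r :: "('i \<times> 'i) set" where r: "well_order_on UNIV r"
    using well_order_on by blast
  then have tot: "total r" and wf: "wf (r - Id)"
    unfolding well_order_on_def linear_order_on_def by auto
  define I where "I \<gamma> = {\<delta>\<in>\<Gamma>. (\<delta>, \<gamma>) \<in> r - Id}" for \<gamma>
  show thesis
  proof (cases "\<exists>\<gamma>. \<not> first_category (\<Union>\<delta>\<in>I \<gamma>. A \<delta>)")
    case True
    then obtain \<gamma> where "\<gamma> \<in> {\<gamma>. \<not> first_category (\<Union>\<delta>\<in>I \<gamma>. A \<delta>)}"
      by blast
    from wfE_min[OF wf this] obtain \<gamma>\<^sub>0 where \<gamma>\<^sub>0: "\<not> first_category (\<Union>\<delta>\<in>I \<gamma>\<^sub>0. A \<delta>)"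
        "\<And>\<gamma>. (\<gamma>, \<gamma>\<^sub>0) \<in> r - Id \<Longrightarrow> first_category (\<Union>\<delta>\<in>I \<gamma>. A \<delta>)"
      by auto
    show thesis
    proof (rule that[OF _ \<gamma>\<^sub>0(1) tot])
      show "I \<gamma>\<^sub>0 \<subseteq> \<Gamma>"
        unfolding I_def by blast
      show "first_category (\<Union>\<delta>\<in>{\<delta>\<in>I \<gamma>\<^sub>0. (\<delta>, \<gamma>) \<in> r - Id}. A \<delta>)" if "\<gamma> \<in> I \<gamma>\<^sub>0" for \<gamma>
      proof (rule first_category_subset)
        show "first_category (\<Union>\<delta>\<in>I \<gamma>. A \<delta>)"
          using that by (intro \<gamma>\<^sub>0(2)) (simp add: I_def)
        show "(\<Union>\<delta>\<in>{\<delta>\<in>I \<gamma>\<^sub>0. (\<delta>, \<gamma>) \<in> r - Id}. A \<delta>) \<subseteq> (\<Union>\<delta>\<in>I \<gamma>. A \<delta>)"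
          unfolding I_def by blast
      qed
    qed
  next
    case False
    then show thesis
      using that[OF subset_refl assms tot] unfolding I_def by blast
  qed
qed

theorem theorem3p1:
  fixes A :: "'i \<Rightarrow> 'a::second_countable_topology set"
    and \<Gamma> :: "'i set"
  assumes "disjoint_family_on A \<Gamma>"
    and "\<And>\<gamma>. \<gamma> \<in> \<Gamma> \<Longrightarrow> first_category (A \<gamma>)"
    and "second_category (\<Union>\<gamma>\<in>\<Gamma>. A \<gamma>)"
  shows "\<exists>\<Delta> U. \<Delta> \<subseteq> \<Gamma> \<and> open U \<and> U \<noteq> {} \<and>
      everywhere_second_category_in (\<Union>\<gamma>\<in>\<Delta>. A \<gamma>) U \<and>
      everywhere_second_category_in (\<Union>\<gamma>\<in>\<Gamma> - \<Delta>. A \<gamma>) U \<and>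
      \<not> separated_by_baire_property (\<Union>\<gamma>\<in>\<Delta>. A \<gamma>) (\<Union>\<gamma>\<in>\<Gamma> - \<Delta>. A \<gamma>)"
proof -
  obtain \<Gamma>' and r :: "('i \<times> 'i) set" where \<Gamma>': "\<Gamma>' \<subseteq> \<Gamma>" "\<not> first_category (\<Union>\<gamma>\<in>\<Gamma>'. A \<gamma>)"
    and tot: "total r"
    and below: "\<And>\<gamma>. \<gamma> \<in> \<Gamma>' \<Longrightarrow> first_category (\<Union>\<delta>\<in>{\<delta>\<in>\<Gamma>'. (\<delta>, \<gamma>) \<in> r - Id}. A \<delta>)"
    using minimal_second_category_subfamily[OF assms(3)[unfolded second_category_def]] by blast
  \<comment> \<open>By totality, an index not strictly after \<open>\<delta>\<close> is
    \<open>\<delta>\<close> itself or comes before it.\<close>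
  have above: "first_category (\<Union>\<gamma>\<in>{\<gamma>\<in>\<Gamma>'. (\<delta>, \<gamma>) \<notin> r - Id}. A \<gamma>)" if "\<delta> \<in> \<Gamma>'" for \<delta>
  proof (rule first_category_subset)
    show "first_category (A \<delta> \<union> (\<Union>\<gamma>\<in>{\<gamma>\<in>\<Gamma>'. (\<gamma>, \<delta>) \<in> r - Id}. A \<gamma>))"
      using that \<Gamma>'(1) by (intro first_category_Un assms(2) below) auto
    show "(\<Union>\<gamma>\<in>{\<gamma>\<in>\<Gamma>'. (\<delta>, \<gamma>) \<notin> r - Id}. A \<gamma>) \<subseteq> A \<delta> \<union> (\<Union>\<gamma>\<in>{\<gamma>\<in>\<Gamma>'. (\<gamma>, \<delta>) \<in> r - Id}. A \<gamma>)"
    proof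
      fix x assume "x \<in> (\<Union>\<gamma>\<in>{\<gamma>\<in>\<Gamma>'. (\<delta>, \<gamma>) \<notin> r - Id}. A \<gamma>)"
      then obtain \<gamma> where \<gamma>: "\<gamma> \<in> \<Gamma>'" "(\<delta>, \<gamma>) \<notin> r - Id" "x \<in> A \<gamma>"
        by auto
      then have "\<gamma> = \<delta> \<or> (\<gamma>, \<delta>) \<in> r - Id"
        using tot unfolding total_on_def by auto
      with \<gamma> show "x \<in> A \<delta> \<union> (\<Union>\<gamma>\<in>{\<gamma>\<in>\<Gamma>'. (\<gamma>, \<delta>) \<in> r - Id}. A \<gamma>)"
        by auto
    qed
  qed
  have "\<exists>\<Delta>\<subseteq>\<Gamma>'. \<exists>U. open U \<and> U \<noteq> {} \<and> everywhere_second_category_in (\<Union>\<gamma>\<in>\<Delta>. A \<gamma>) U \<and>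
      everywhere_second_category_in (\<Union>\<gamma>\<in>\<Gamma>' - \<Delta>. A \<gamma>) U"
  proof (rule ccontr)
    assume *: "\<not> ?thesis"
    have "first_category (\<Union>\<gamma>\<in>\<Gamma>'. A \<gamma>)"
      by (rule first_category_union_if_subunions_relatively_open[OF below above],
          assumption, assumption, rule relatively_open_if_not_split) (use * in blast)
    with \<Gamma>'(2) show False ..
  qed
  then obtain \<Delta> U where \<Delta>: "\<Delta> \<subseteq> \<Gamma>'" and U: "open U" "U \<noteq> {}"
      "everywhere_second_category_in (\<Union>\<gamma>\<in>\<Delta>. A \<gamma>) U"
      "everywhere_second_category_in (\<Union>\<gamma>\<in>\<Gamma>' - \<Delta>. A \<gamma>) U"
    by blast
  \<comment> \<open>The indices cut off from \<open>\<Gamma>\<close> are assigned to the complement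
    of \<open>\<Delta>\<close>, which only enlarges that union.\<close>
  have compl: "everywhere_second_category_in (\<Union>\<gamma>\<in>\<Gamma> - \<Delta>. A \<gamma>) U"
    by (rule everywhere_second_category_in_mono[OF U(4)]) (use \<Gamma>'(1) in blast)
  show ?thesis
    using \<Delta> \<Gamma>'(1) U(1-3) compl not_separated_if_split[OF U(1-3) compl]
    by (intro exI[of _ \<Delta>] exI[of _ U]) simp
qed

end
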